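(* Let $X$ be a real-valued random variable on a probability space $(\Omega,\mathcal{F},\mathbb{P})$ with finite variance $\sigma^2$ and expected value $\mathbb{E}(X)$. Let $n\ge 1$ and let $0<\lambda_1<\lambda_2<\cdots<\lambda_n<\infty$ be real numbers. Then $$\sum_{k=1}^{n}\frac{(\lambda_1\lambda_k+\sigma^2)^2-(\lambda_1\lambda_{k-1}+\sigma^2)^2}{(\lambda_1^2+\sigma^2)^2}\,\mathbb{P}(X-\mathbb{E}(X)\ge\lambda_k)\le\frac{\sigma^2}{\sigma^2+\lambda_1^2},$$ where $\lambda_0=-\dfrac{\sigma^2}{\lambda_1}$.
   Context: $\sigma^2=\mathbb{E}\big((X-\mathbb{E}(X))^2\big)$ is the variance of $X$; finite variance means in particular that $\mathbb{E}(X)$ is a finite real number. With the stated value of $\lambda_0$, the coefficient of the $k=1$ term equals $1$. *)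

theory Defs
  imports "HOL-Probability.Probability"
begin

end

theory Submission
  imports Defs
begin

text \<open>
  Write \<open>Y = X - E X\<close> and \<open>g y = (\<lambda>\<^sub>1 y + \<sigma>\<^sup>2)\<^sup>2\<close>. The usual proof of Cantelli's inequality
  applies Markov's inequality to \<open>g Y\<close>, that is, it bounds the single step
  \<open>g \<lambda>\<^sub>1 \<cdot> 1[Y \<ge> \<lambda>\<^sub>1]\<close> by \<open>g Y\<close>. Here the left-hand side is, up to the factor
  \<open>1 / (\<lambda>\<^sub>1\<^sup>2 + \<sigma>\<^sup>2)\<^sup>2\<close>, the expectation of a finer step function below the same parabola.
  The value \<open>\<lambda>\<^sub>0\<close> is the zero of \<open>g\<close>, so at a point where \<open>\<lambda>\<^sub>m\<close> is the last level
  reached by \<open>Y\<close>, the sum of the increments of \<open>g\<close> telescopes to \<open>g \<lambda>\<^sub>m\<close>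
  (\<open>sum_increments_le\<close>), and \<open>g \<lambda>\<^sub>m \<le> g Y\<close> because \<open>g\<close> increases on the positive half-line.
  Taking expectations leaves \<open>E (g Y) = \<sigma>\<^sup>2 (\<lambda>\<^sub>1\<^sup>2 + \<sigma>\<^sup>2)\<close>, since \<open>Y\<close> is centred.
\<close>

text \<open>
  As \<open>P\<close> holds on an initial segment, only the increments up to its last index survive, and they
  telescope. \<open>B \<ge> 0\<close> covers the empty segment.
\<close>

lemma sum_increments_le:
  fixes a :: "nat \<Rightarrow> real"
  assumes "0 \<le> B"
    and "\<And>j k. 1 \<le> j \<Longrightarrow> j \<le> k \<Longrightarrow> k \<le> n \<Longrightarrow> P k \<Longrightarrow> P j"
    and "\<And>k. 1 \<le> k \<Longrightarrow> k \<le> n \<Longrightarrow> P k \<Longrightarrow> a k - a 0 \<le> B"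
  shows "(\<Sum>k=1..n. (a k - a (k - 1)) * of_bool (P k)) \<le> B"
  using assms
proof (induction n)
  case 0
  then show ?case by simp
next
  case (Suc n)
  show ?case
  proof (cases "P (Suc n)")
    case True
    have "P k" if "k \<in> {1..Suc n}" for k
      using Suc.prems(2)[of k "Suc n"] that True by simp
    then have "(\<Sum>k=1..Suc n. (a k - a (k - 1)) * of_bool (P k))
        = (\<Sum>k=1..Suc n. a k - a (k - 1))"
      by (intro sum.cong) auto
    also have "\<dots> = a (Suc n) - a 0"
      using sum_telescope''[of 0 "Suc n" a] by simp
    also have "\<dots> \<le> B"
      using Suc.prems(3)[of "Suc n"] True by simp
    finally show ?thesis .
  next
    case False
    have "(\<Sum>k=1..n. (a k - a (k - 1)) * of_bool (P k)) \<le> B"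
      by (rule Suc.IH) (use Suc.prems in auto)
    with False show ?thesis by simp
  qed
qed

theorem theorem3p5:
  fixes M :: "'a measure" and X :: "'a \<Rightarrow> real"
    and \<sigma> :: real and l :: "nat \<Rightarrow> real" and n :: nat
  assumes "prob_space M"
    and "X \<in> borel_measurable M"
    and "integrable M X"
    and "integrable M (\<lambda>\<omega>. (X \<omega> - prob_space.expectation M X)\<^sup>2)"
    and "\<sigma>\<^sup>2 = prob_space.variance M X"
    and "n \<ge> 1"
    and "0 < l 1"
    and "strict_mono_on {1..n} l"
    and "l 0 = - \<sigma>\<^sup>2 / l 1"
  shows "(\<Sum>k=1..n. ((l 1 * l k + \<sigma>\<^sup>2)\<^sup>2 - (l 1 * l (k - 1) + \<sigma>\<^sup>2)\<^sup>2) / ((l 1)\<^sup>2 + \<sigma>\<^sup>2)\<^sup>2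
            * \<P>(\<omega> in M. X \<omega> - prob_space.expectation M X \<ge> l k))
         \<le> \<sigma>\<^sup>2 / (\<sigma>\<^sup>2 + (l 1)\<^sup>2)"
proof -
  interpret prob_space M by fact
  define Y where "Y = (\<lambda>\<omega>. X \<omega> - expectation X)"
  define a where "a k = (l 1 * l k + \<sigma>\<^sup>2)\<^sup>2" for k
  define D where "D = (l 1)\<^sup>2 + \<sigma>\<^sup>2"
  define S where "S k = {\<omega> \<in> space M. l k \<le> Y \<omega>}" for k
  have D_pos: "D > 0"
    unfolding D_def using assms(7) by (simp add: add_pos_nonneg)
  have a_0: "a 0 = 0"
    unfolding a_def using assms(7,9) by simp
  have Y_meas [measurable]: "Y \<in> borel_measurable M"
    unfolding Y_def using assms(2) by measurable
  have S_sets [measurable]: "S k \<in> sets M" for k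
    unfolding S_def by measurable
  have Y_int: "integrable M Y" and Y2_int: "integrable M (\<lambda>\<omega>. (Y \<omega>)\<^sup>2)"
    unfolding Y_def using assms(3,4) by auto
  have Y_centred: "expectation Y = 0"
    unfolding Y_def using assms(3) by (simp add: prob_space)
  have Y_variance: "expectation (\<lambda>\<omega>. (Y \<omega>)\<^sup>2) = \<sigma>\<^sup>2"
    unfolding Y_def using assms(5) by simp
  have g_eq: "(\<lambda>\<omega>. (l 1 * Y \<omega> + \<sigma>\<^sup>2)\<^sup>2)
      = (\<lambda>\<omega>. (l 1)\<^sup>2 * (Y \<omega>)\<^sup>2 + (2 * l 1 * \<sigma>\<^sup>2) * Y \<omega> + (\<sigma>\<^sup>2)\<^sup>2)"
    by (simp add: power2_eq_square algebra_simps)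
  have g_int: "integrable M (\<lambda>\<omega>. (l 1 * Y \<omega> + \<sigma>\<^sup>2)\<^sup>2)"
    unfolding g_eq using Y_int Y2_int by simp
  have "expectation (\<lambda>\<omega>. (l 1 * Y \<omega> + \<sigma>\<^sup>2)\<^sup>2) = (l 1)\<^sup>2 * \<sigma>\<^sup>2 + (\<sigma>\<^sup>2)\<^sup>2"
    unfolding g_eq using Y_int Y2_int Y_centred Y_variance
    by (simp add: prob_space)
  then have g_expectation: "expectation (\<lambda>\<omega>. (l 1 * Y \<omega> + \<sigma>\<^sup>2)\<^sup>2) = \<sigma>\<^sup>2 * D"
    by (simp add: D_def power2_eq_square algebra_simps)
  have mono_l: "l j \<le> l k" if "1 \<le> j" "j \<le> k" "k \<le> n" for j k
    using strict_mono_on_leD[OF assms(8), of j k] that by simp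
  have step_le_parabola:
    "(\<Sum>k=1..n. (a k - a (k - 1)) * indicator (S k) \<omega>) \<le> (l 1 * Y \<omega> + \<sigma>\<^sup>2)\<^sup>2"
    if "\<omega> \<in> space M" for \<omega>
  proof -
    have "(\<Sum>k=1..n. (a k - a (k - 1)) * of_bool (l k \<le> Y \<omega>)) \<le> (l 1 * Y \<omega> + \<sigma>\<^sup>2)\<^sup>2"
    proof (rule sum_increments_le)
      show "l j \<le> Y \<omega>" if "1 \<le> j" "j \<le> k" "k \<le> n" "l k \<le> Y \<omega>" for j k
        using mono_l[of j k] that by simp
      show "a k - a 0 \<le> (l 1 * Y \<omega> + \<sigma>\<^sup>2)\<^sup>2" if "1 \<le> k" "k \<le> n" "l k \<le> Y \<omega>" for k
      proof -
        have "0 \<le> l k"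
          using mono_l[of 1 k] that assms(7) by simp
        then have "a k \<le> (l 1 * Y \<omega> + \<sigma>\<^sup>2)\<^sup>2"
          unfolding a_def using that assms(7)
          by (intro power_mono add_right_mono mult_left_mono) auto
        then show ?thesis
          by (simp add: a_0)
      qed
    qed simp
    then show ?thesis
      using that by (simp add: S_def indicator_def of_bool_def)
  qed
  have step_int: "integrable M (\<lambda>\<omega>. (a k - a (k - 1)) * indicator (S k) \<omega>)" for k
    by (intro integrable_mult_right integrable_real_indicator)
       (simp_all add: emeasure_eq_measure)
  have "(\<Sum>k=1..n. (a k - a (k - 1)) * prob (S k))
      = expectation (\<lambda>\<omega>. \<Sum>k=1..n. (a k - a (k - 1)) * indicator (S k) \<omega>)"
    using step_int by (subst Bochner_Integration.integral_sum) auto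
  also have "\<dots> \<le> \<sigma>\<^sup>2 * D"
    unfolding g_expectation[symmetric]
    by (rule integral_mono[OF Bochner_Integration.integrable_sum[OF step_int] g_int step_le_parabola])
  finally have sum_le: "(\<Sum>k=1..n. (a k - a (k - 1)) * prob (S k)) \<le> \<sigma>\<^sup>2 * D" .
  have "(\<Sum>k=1..n. (a k - a (k - 1)) / D\<^sup>2 * prob (S k))
      = (\<Sum>k=1..n. (a k - a (k - 1)) * prob (S k)) / D\<^sup>2"
    by (simp add: sum_divide_distrib)
  also have "\<dots> \<le> \<sigma>\<^sup>2 * D / D\<^sup>2"
    by (rule divide_right_mono[OF sum_le]) simp
  also have "\<dots> = \<sigma>\<^sup>2 / D"
    using D_pos by (simp add: power2_eq_square)
  finally show ?thesis
    unfolding a_def D_def S_def Y_def by (simp add: add.commute)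
qed

end
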